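(* Let $\mu$ be a Borel probability measure on $\mathbb{R}$ and assume that $\Gamma\subset\mathbb{N}_0$ is a spectrum for $\mu$. Then: (i) The map $J$ defined by $Je_\gamma = z^\gamma$ for $\gamma\in\Gamma$ extends to an isometric (linear) embedding $J: L^2(\mu)\to H^2$. (ii) Define the map $G$ on $\mathbb{D}\times\mathbb{R}$ by $$G(z,x):=\sum_{\gamma\in\Gamma}\overline{z}^{\,\gamma} e_\gamma(x),\quad (z\in\mathbb{D},\ x\in\mathbb{R}).$$ Then for every $f\in L^2(\mu)$, $$(Jf)(z)=\int f(x)\,\overline{G(z,x)}\,d\mu(x)=\langle G(z,\cdot), f\rangle_{L^2(\mu)},\quad (z\in\mathbb{D}).$$ (iii) Assume in addition that $\Gamma=R\Gamma+L$ for some $R\in\mathbb{N}$, $R\geq 2$, and some finite set $L\subset\mathbb{N}_0$ such that no two distinct elements of $L$ are congruent modulo $R$. Then $$\overline{G(z,x)}=\prod_{n=0}^\infty\left(\sum_{l\in L} z^{R^n l}\,\overline{e_l(R^n x)}\right),\quad (z\in\mathbb{D},\ x\in\mathbb{R}),$$ and the infinite product is uniformly convergent for $z$ in compact subsets of $\mathbb{D}$ and $x\in\mathbb{R}$.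
   Context: $\mathbb{N}_0=\{0,1,2,\dots\}$; $\mathbb{D}$ is the open unit disk in $\mathbb{C}$. For $t\in\mathbb{R}$, $e_t(x)=e^{2\pi i t x}$. A set $\Gamma$ is a spectrum for $\mu$ if $\{e_\gamma:\gamma\in\Gamma\}$ is an orthonormal basis of $L^2(\mu)$. $H^2=H^2(\mathbb{D})$ is the Hardy space of analytic functions $f(z)=\sum_{n\ge0}c_nz^n$ on $\mathbb{D}$ with $\|f\|_{H^2}^2=\sum_{n\ge 0}|c_n|^2<\infty$; in $Je_\gamma=z^\gamma$, $z^\gamma$ denotes the monomial function $z\mapsto z^\gamma$. Inner products are conjugate-linear in the first variable and linear in the second, so $\langle g,f\rangle_{L^2(\mu)}=\int\overline{g}f\,d\mu$. $R\Gamma+L=\{R\gamma+l:\gamma\in\Gamma,\ l\in L\}$. Convention: $0^0=1$. *)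

theory Defs
  imports "HOL-Probability.Probability"
begin

definition char_exp :: "real \<Rightarrow> real \<Rightarrow> complex" where
  "char_exp t x = exp (2 * of_real pi * \<i> * of_real t * of_real x)"

text \<open>Elements of $L^2(M)$ are represented by square-integrable functions;
  functions that agree almost everywhere represent the same element.\<close>

definition L2 :: "'a measure \<Rightarrow> ('a \<Rightarrow> complex) set" where
  "L2 M = {f \<in> borel_measurable M. integrable M (\<lambda>x. (cmod (f x))\<^sup>2)}"

text \<open>Conjugate-linear in the first argument.\<close>

definition L2_inner :: "'a measure \<Rightarrow> ('a \<Rightarrow> complex) \<Rightarrow> ('a \<Rightarrow> complex) \<Rightarrow> complex" where
  "L2_inner M g f = (LINT x|M. cnj (g x) * f x)"

definition L2_norm :: "'a measure \<Rightarrow> ('a \<Rightarrow> complex) \<Rightarrow> real" where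
  "L2_norm M f = sqrt (LINT x|M. (cmod (f x))\<^sup>2)"

text \<open>An orthonormal basis, as an indexed family: orthonormal (so distinct indices give
  distinct, orthogonal elements) with dense linear span.\<close>

definition orthonormal_basis_L2 :: "'a measure \<Rightarrow> 'i set \<Rightarrow> ('i \<Rightarrow> 'a \<Rightarrow> complex) \<Rightarrow> bool" where
  "orthonormal_basis_L2 M I b \<longleftrightarrow>
     (\<forall>i\<in>I. b i \<in> L2 M) \<and>
     (\<forall>i\<in>I. \<forall>j\<in>I. L2_inner M (b i) (b j) = (if i = j then 1 else 0)) \<and>
     (\<forall>f\<in>L2 M. \<forall>\<epsilon>>0. \<exists>F c. finite F \<and> F \<subseteq> I \<and>
        L2_norm M (\<lambda>x. f x - (\<Sum>i\<in>F. c i * b i x)) < \<epsilon>)"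

definition is_spectrum :: "real measure \<Rightarrow> real set \<Rightarrow> bool" where
  "is_spectrum M \<Lambda> \<longleftrightarrow> orthonormal_basis_L2 M \<Lambda> char_exp"

definition taylor_coeff :: "(complex \<Rightarrow> complex) \<Rightarrow> nat \<Rightarrow> complex" where
  "taylor_coeff f n = (deriv ^^ n) f 0 / fact n"

text \<open>Members of the Hardy space matter only through their values on the open unit disk;
  the values that HOL's total functions take elsewhere are ignored.\<close>

definition H2 :: "(complex \<Rightarrow> complex) set" where
  "H2 = {f. f holomorphic_on ball 0 1 \<and> summable (\<lambda>n. (cmod (taylor_coeff f n))\<^sup>2)}"

definition H2_norm :: "(complex \<Rightarrow> complex) \<Rightarrow> real" where
  "H2_norm f = sqrt (\<Sum>n. (cmod (taylor_coeff f n))\<^sup>2)"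

text \<open>The second conjunct says that \<^term>\<open>J\<close> is well defined on classes modulo
  almost-everywhere equality. Equality in the Hardy space is equality on the disk.\<close>

definition isometric_embedding_L2_H2 ::
    "'a measure \<Rightarrow> (('a \<Rightarrow> complex) \<Rightarrow> complex \<Rightarrow> complex) \<Rightarrow> bool" where
  "isometric_embedding_L2_H2 M J \<longleftrightarrow>
     (\<forall>f\<in>L2 M. J f \<in> H2) \<and>
     (\<forall>f\<in>L2 M. \<forall>g\<in>L2 M. (AE x in M. f x = g x) \<longrightarrow> (\<forall>z\<in>ball 0 1. J f z = J g z)) \<and>
     (\<forall>f\<in>L2 M. \<forall>g\<in>L2 M. \<forall>a b. \<forall>z\<in>ball 0 1.
        J (\<lambda>x. a * f x + b * g x) z = a * J f z + b * J g z) \<and>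
     (\<forall>f\<in>L2 M. H2_norm (J f) = L2_norm M f)"

definition spectrum_embedding ::
    "real measure \<Rightarrow> nat set \<Rightarrow> ((real \<Rightarrow> complex) \<Rightarrow> complex \<Rightarrow> complex) \<Rightarrow> bool" where
  "spectrum_embedding M \<Gamma> J \<longleftrightarrow>
     isometric_embedding_L2_H2 M J \<and>
     (\<forall>\<gamma>\<in>\<Gamma>. \<forall>z\<in>ball 0 1. J (char_exp (real \<gamma>)) z = z ^ \<gamma>)"

definition G :: "nat set \<Rightarrow> complex \<Rightarrow> real \<Rightarrow> complex" where
  "G \<Gamma> z x = (\<Sum>\<^sub>\<infinity>\<gamma>\<in>\<Gamma>. cnj z ^ \<gamma> * char_exp (real \<gamma>) x)"

definition G_factor :: "nat \<Rightarrow> nat set \<Rightarrow> nat \<Rightarrow> complex \<Rightarrow> real \<Rightarrow> complex" where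
  "G_factor R L n z x = (\<Sum>l\<in>L. z ^ (R ^ n * l) * cnj (char_exp (real l) (real R ^ n * x)))"

end

theory Submission
  imports Defs "HOL-Complex_Analysis.Cauchy_Integral_Formula"
begin

text \<open>
  Write \<open>c\<^sub>n = \<langle>e\<^sub>n, f\<rangle>\<close> for \<open>n \<in> \<Gamma>\<close> and \<open>c\<^sub>n = 0\<close> otherwise. The spectrum
  is indexed by natural numbers, so the Fourier coefficients of \<open>f\<close> can be read as Taylor coefficients,
  and \<open>J f = \<Sum> c\<^sub>n z\<^sup>n\<close>. Parseval's identity (\<open>parseval\<close>) says precisely that this map is
  isometric. Point evaluations are continuous on the Hardy space (\<open>H2_pointwise_bound\<close>), so density
  of the span shows that no other isometric embedding sends \<open>e\<^sub>\<gamma>\<close> to \<open>z\<^sup>\<gamma>\<close>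
  (\<open>isometric_embedding_unique\<close>). The kernel formula therefore needs to be checked for this \<open>J\<close>
  only, where it is an exchange of summation and integration
  (\<open>monomial_embedding_eq_kernel_integral\<close>).

  For the product, put \<open>w = z e\<^sub>-\<^sub>1(x)\<close>. The conjugate of \<open>G(z, x)\<close> is \<open>g(w)\<close> with
  \<open>g(w) = \<Sum>\<^bsub>\<gamma> \<in> \<Gamma>\<^esub> w\<^sup>\<gamma>\<close>, and the \<open>n\<close>-th factor is \<open>P(w\<^sup>k)\<close> with
  \<open>k = R\<^sup>n\<close> and \<open>P(w) = \<Sum>\<^bsub>l \<in> L\<^esub> w\<^sup>l\<close>. Since every exponent is \<open>R\<gamma> + l\<close> in
  exactly one way, \<open>g(w) = P(w) g(w\<^sup>R)\<close> (\<open>gap_series_step\<close>). Iterating, \<open>g(w)\<close> is a partial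
  product times \<open>g\<close> at a high power of \<open>w\<close>, and this last factor tends to \<open>g(0) = 1\<close>, because
  self-similarity forces \<open>0 \<in> \<Gamma>\<close>. An explicit error bound valid for all \<open>\<bar>w\<bar> \<le> r < 1\<close>
  (\<open>partial_product_error\<close>) gives uniform convergence.
\<close>

section \<open>Square-integrable functions and Parseval's identity\<close>

lemma borel_measurable_cnj [measurable (raw)]:
  "f \<in> borel_measurable M \<Longrightarrow> (\<lambda>x. cnj (f x)) \<in> borel_measurable M"
  by (rule borel_measurable_continuous_on[of cnj]) (auto intro: continuous_intros)

lemma integrable_L2_mult:
  assumes "f \<in> L2 M" "g \<in> L2 M"
  shows "integrable M (\<lambda>x. cnj (f x) * g x)"
proof -
  have [measurable]: "f \<in> borel_measurable M" "g \<in> borel_measurable M"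
    using assms by (auto simp: L2_def)
  show ?thesis
  proof (rule Bochner_Integration.integrable_bound)
    show "integrable M (\<lambda>x. (cmod (f x))\<^sup>2 + (cmod (g x))\<^sup>2)"
      using assms by (auto simp: L2_def)
    show "AE x in M. norm (cnj (f x) * g x) \<le> norm ((cmod (f x))\<^sup>2 + (cmod (g x))\<^sup>2)"
    proof (rule AE_I2)
      fix x
      have "2 * (cmod (f x) * cmod (g x)) \<le> (cmod (f x))\<^sup>2 + (cmod (g x))\<^sup>2"
        using sum_squares_bound[of "cmod (f x)" "cmod (g x)"] by simp
      moreover have "0 \<le> cmod (f x) * cmod (g x)"
        by simp
      ultimately have "cmod (f x) * cmod (g x) \<le> (cmod (f x))\<^sup>2 + (cmod (g x))\<^sup>2"
        by linarith
      then show "norm (cnj (f x) * g x) \<le> norm ((cmod (f x))\<^sup>2 + (cmod (g x))\<^sup>2)"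
        by (simp add: norm_mult)
    qed
  qed measurable
qed

lemma L2_lincomb:
  assumes "f \<in> L2 M" "g \<in> L2 M"
  shows "(\<lambda>x. a * f x + b * g x) \<in> L2 M"
proof -
  have [measurable]: "f \<in> borel_measurable M" "g \<in> borel_measurable M"
    using assms by (auto simp: L2_def)
  have "integrable M (\<lambda>x. (cmod (a * f x + b * g x))\<^sup>2)"
  proof (rule Bochner_Integration.integrable_bound)
    show "integrable M (\<lambda>x. 2 * (cmod a)\<^sup>2 * (cmod (f x))\<^sup>2 + 2 * (cmod b)\<^sup>2 * (cmod (g x))\<^sup>2)"
      using assms by (auto simp: L2_def)
    show "AE x in M. norm ((cmod (a * f x + b * g x))\<^sup>2)
        \<le> norm (2 * (cmod a)\<^sup>2 * (cmod (f x))\<^sup>2 + 2 * (cmod b)\<^sup>2 * (cmod (g x))\<^sup>2)"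
    proof (rule AE_I2)
      fix x
      let ?u = "cmod a * cmod (f x)" and ?v = "cmod b * cmod (g x)"
      have "cmod (a * f x + b * g x) \<le> ?u + ?v"
        by (metis norm_mult norm_triangle_ineq)
      then have "(cmod (a * f x + b * g x))\<^sup>2 \<le> (?u + ?v)\<^sup>2"
        by (intro power_mono) auto
      also have "\<dots> \<le> 2 * ?u\<^sup>2 + 2 * ?v\<^sup>2"
        using sum_squares_bound[of ?u ?v] by (simp add: power2_sum)
      finally show "norm ((cmod (a * f x + b * g x))\<^sup>2)
        \<le> norm (2 * (cmod a)\<^sup>2 * (cmod (f x))\<^sup>2 + 2 * (cmod b)\<^sup>2 * (cmod (g x))\<^sup>2)"
        by (simp add: power_mult_distrib)
    qed
  qed measurable
  then show ?thesis
    by (simp add: L2_def)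
qed

lemma zero_in_L2: "(\<lambda>x. 0) \<in> L2 M"
  by (simp add: L2_def)

lemma L2_sum:
  assumes "finite F" "\<And>i. i \<in> F \<Longrightarrow> b i \<in> L2 M"
  shows "(\<lambda>x. \<Sum>i\<in>F. c i * b i x) \<in> L2 M"
  using assms
proof (induction F rule: finite_induct)
  case (insert i F)
  then have "(\<lambda>x. c i * b i x + 1 * (\<Sum>i\<in>F. c i * b i x)) \<in> L2 M"
    by (intro L2_lincomb) auto
  with insert.hyps show ?case
    by simp
qed (simp add: zero_in_L2)

lemma L2_inner_lincomb:
  assumes "h \<in> L2 M" "f \<in> L2 M" "g \<in> L2 M"
  shows "L2_inner M h (\<lambda>x. a * f x + b * g x) = a * L2_inner M h f + b * L2_inner M h g"
proof -
  have "L2_inner M h (\<lambda>x. a * f x + b * g x)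
      = (LINT x|M. a * (cnj (h x) * f x) + b * (cnj (h x) * g x))"
    unfolding L2_inner_def by (simp add: algebra_simps)
  also have "\<dots> = a * L2_inner M h f + b * L2_inner M h g"
    unfolding L2_inner_def using assms by (simp add: integrable_L2_mult)
  finally show ?thesis .
qed

lemma L2_inner_sum:
  assumes "h \<in> L2 M" "finite F" "\<And>i. i \<in> F \<Longrightarrow> b i \<in> L2 M"
  shows "L2_inner M h (\<lambda>x. \<Sum>i\<in>F. c i * b i x) = (\<Sum>i\<in>F. c i * L2_inner M h (b i))"
proof -
  have "L2_inner M h (\<lambda>x. \<Sum>i\<in>F. c i * b i x) = (LINT x|M. (\<Sum>i\<in>F. c i * (cnj (h x) * b i x)))"
    unfolding L2_inner_def by (simp add: sum_distrib_left algebra_simps)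
  also have "\<dots> = (\<Sum>i\<in>F. c i * L2_inner M h (b i))"
    unfolding L2_inner_def using assms by (simp add: integrable_L2_mult)
  finally show ?thesis .
qed

lemma L2_inner_commute: "L2_inner M f g = cnj (L2_inner M g f)"
  unfolding L2_inner_def by (simp flip: Bochner_Integration.integral_cnj add: mult.commute)

lemma L2_norm_nonneg: "0 \<le> L2_norm M f"
  by (simp add: L2_norm_def)

lemma L2_inner_self: "L2_inner M f f = of_real ((L2_norm M f)\<^sup>2)"
proof -
  have "L2_inner M f f = (LINT x|M. of_real ((cmod (f x))\<^sup>2))"
    unfolding L2_inner_def by (simp only: mult.commute[of "cnj _"] complex_norm_square)
  then show ?thesis
    unfolding integral_complex_of_real by (simp add: L2_norm_def)
qed

text \<open>Completing the square: among all combinations of a finite orthonormal family, the one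
  whose coefficients are the inner products is nearest to \<^term>\<open>f\<close>. Bessel's inequality
  is the case in which both coefficient families agree; Parseval's identity follows because
  the best combination is at least as good as any that density provides.\<close>

lemma L2_norm_minus_orthonormal_sum:
  assumes f: "f \<in> L2 M" and F: "finite F" and b: "\<And>i. i \<in> F \<Longrightarrow> b i \<in> L2 M"
    and on: "\<And>i j. i \<in> F \<Longrightarrow> j \<in> F \<Longrightarrow> L2_inner M (b i) (b j) = (if i = j then 1 else 0)"
  shows "(L2_norm M (\<lambda>x. f x - (\<Sum>i\<in>F. a i * b i x)))\<^sup>2
      = (L2_norm M f)\<^sup>2 - (\<Sum>i\<in>F. (cmod (L2_inner M (b i) f))\<^sup>2)
        + (\<Sum>i\<in>F. (cmod (a i - L2_inner M (b i) f))\<^sup>2)"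
proof -
  let ?c = "\<lambda>i. L2_inner M (b i) f"
  define s where "s = (\<lambda>x. \<Sum>i\<in>F. a i * b i x)"
  define h where "h = (\<lambda>x. 1 * f x + (-1) * s x)"
  have s: "s \<in> L2 M"
    unfolding s_def using F b by (rule L2_sum)
  have h: "h \<in> L2 M"
    unfolding h_def using f s by (rule L2_lincomb)
  have bs: "L2_inner M (b i) s = a i" if "i \<in> F" for i
  proof -
    have "L2_inner M (b i) s = (\<Sum>j\<in>F. a j * L2_inner M (b i) (b j))"
      unfolding s_def using that F b by (intro L2_inner_sum) auto
    also have "\<dots> = (\<Sum>j\<in>F. if i = j then a j else 0)"
      using that on by (intro sum.cong) auto
    finally show ?thesis
      using F that by simp
  qed
  have fs: "L2_inner M f s = (\<Sum>i\<in>F. a i * cnj (?c i))"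
  proof -
    have "L2_inner M f s = (\<Sum>i\<in>F. a i * L2_inner M f (b i))"
      unfolding s_def using f F b by (rule L2_inner_sum)
    then show ?thesis
      by (simp add: L2_inner_commute[of M f "b _"])
  qed
  have ss: "L2_inner M s s = (\<Sum>i\<in>F. a i * cnj (a i))"
  proof -
    have "L2_inner M s (\<lambda>x. \<Sum>i\<in>F. a i * b i x) = (\<Sum>i\<in>F. a i * L2_inner M s (b i))"
      using s F b by (rule L2_inner_sum)
    then have "L2_inner M s s = (\<Sum>i\<in>F. a i * L2_inner M s (b i))"
      unfolding s_def[symmetric] .
    also have "\<dots> = (\<Sum>i\<in>F. a i * cnj (a i))"
      using bs by (intro sum.cong) (auto simp: L2_inner_commute[of M s])
    finally show ?thesis .
  qed
  have hf: "L2_inner M f h = L2_inner M f f - L2_inner M f s"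
    unfolding h_def by (subst L2_inner_lincomb[OF f f s]) simp
  have hs: "L2_inner M s h = cnj (L2_inner M f s) - L2_inner M s s"
    unfolding h_def by (subst L2_inner_lincomb[OF s f s]) (simp add: L2_inner_commute[of M s f])
  have "L2_inner M h h = cnj (L2_inner M f h) - cnj (L2_inner M s h)"
    using L2_inner_lincomb[OF h f s, of 1 "-1"]
    unfolding h_def[symmetric]
    by (simp add: L2_inner_commute[of M h f] L2_inner_commute[of M h s])
  also have "\<dots> = L2_inner M f f - cnj (L2_inner M f s) - L2_inner M f s + L2_inner M s s"
    by (simp add: hf hs L2_inner_self)
  also have "\<dots> = L2_inner M f f - (\<Sum>i\<in>F. ?c i * cnj (?c i))
      + (\<Sum>i\<in>F. (a i - ?c i) * cnj (a i - ?c i))"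
    unfolding fs ss by (simp add: algebra_simps sum.distrib sum_subtractf)
  finally have "complex_of_real ((L2_norm M h)\<^sup>2) = of_real ((L2_norm M f)\<^sup>2
      - (\<Sum>i\<in>F. (cmod (?c i))\<^sup>2) + (\<Sum>i\<in>F. (cmod (a i - ?c i))\<^sup>2))"
    by (simp only: L2_inner_self of_real_add of_real_diff of_real_sum complex_norm_square)
  then show ?thesis
    unfolding of_real_eq_iff by (simp add: h_def s_def)
qed

theorem parseval:
  assumes onb: "orthonormal_basis_L2 M I b" and f: "f \<in> L2 M"
  shows "((\<lambda>i. (cmod (L2_inner M (b i) f))\<^sup>2) has_sum (L2_norm M f)\<^sup>2) I"
proof -
  let ?q = "\<lambda>i. (cmod (L2_inner M (b i) f))\<^sup>2"
  have split: "(L2_norm M (\<lambda>x. f x - (\<Sum>i\<in>F. a i * b i x)))\<^sup>2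
      = (L2_norm M f)\<^sup>2 - sum ?q F + (\<Sum>i\<in>F. (cmod (a i - L2_inner M (b i) f))\<^sup>2)"
    if "finite F" "F \<subseteq> I" for F a
  proof (rule L2_norm_minus_orthonormal_sum[OF f that(1)])
    show "b i \<in> L2 M" if "i \<in> F" for i
      using onb \<open>F \<subseteq> I\<close> that unfolding orthonormal_basis_L2_def by blast
    show "L2_inner M (b i) (b j) = (if i = j then 1 else 0)" if "i \<in> F" "j \<in> F" for i j
      using onb \<open>F \<subseteq> I\<close> that unfolding orthonormal_basis_L2_def by blast
  qed
  have bessel: "sum ?q F \<le> (L2_norm M f)\<^sup>2" if "finite F" "F \<subseteq> I" for F
    using split[OF that, of "\<lambda>i. L2_inner M (b i) f"]
      zero_le_power2[of "L2_norm M (\<lambda>x. f x - (\<Sum>i\<in>F. L2_inner M (b i) f * b i x))"]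
    by simp
  have near: "\<exists>F. finite F \<and> F \<subseteq> I \<and> (L2_norm M f)\<^sup>2 - e < sum ?q F" if "e > 0" for e
  proof -
    have "0 < sqrt e"
      using that by simp
    then obtain F a where F: "finite F" "F \<subseteq> I"
      and d: "L2_norm M (\<lambda>x. f x - (\<Sum>i\<in>F. a i * b i x)) < sqrt e"
      using onb f unfolding orthonormal_basis_L2_def by meson
    have "(L2_norm M (\<lambda>x. f x - (\<Sum>i\<in>F. a i * b i x)))\<^sup>2 < (sqrt e)\<^sup>2"
      using d L2_norm_nonneg by (intro power_strict_mono) auto
    moreover have "0 \<le> (\<Sum>i\<in>F. (cmod (a i - L2_inner M (b i) f))\<^sup>2)"
      by (intro sum_nonneg) auto
    ultimately show ?thesis
      using split[OF F, of a] F that by (intro exI[of _ F]) auto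
  qed
  have bdd: "bdd_above (sum ?q ` {F. F \<subseteq> I \<and> finite F})"
    using bessel by (intro bdd_aboveI[of _ "(L2_norm M f)\<^sup>2"]) auto
  have "(SUP F\<in>{F. finite F \<and> F \<subseteq> I}. sum ?q F) = (L2_norm M f)\<^sup>2"
  proof (rule cSup_eq_non_empty)
    fix y assume y: "\<And>x. x \<in> sum ?q ` {F. finite F \<and> F \<subseteq> I} \<Longrightarrow> x \<le> y"
    show "(L2_norm M f)\<^sup>2 \<le> y"
    proof (rule field_le_epsilon)
      fix e :: real assume "e > 0"
      from near[OF this] y show "(L2_norm M f)\<^sup>2 \<le> y + e"
        by fastforce
    qed
  qed (use bessel in auto)
  with nonneg_bdd_above_has_sum[of I ?q, OF _ bdd] show ?thesis
    by simp
qed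

section \<open>Power series in the Hardy space\<close>

lemma summable_bounded_coeffs:
  fixes c :: "nat \<Rightarrow> complex"
  assumes "\<And>n. cmod (c n) \<le> B" "cmod z < 1"
  shows "summable (\<lambda>n. norm (c n * z ^ n))"
proof (rule summable_comparison_test')
  show "summable (\<lambda>n. B * cmod z ^ n)"
    using assms by (intro summable_mult summable_geometric) auto
  show "norm (norm (c n * z ^ n)) \<le> B * cmod z ^ n" for n
    using assms(1)[of n] by (simp add: norm_mult norm_power mult_right_mono)
qed

lemma power_series_on_disk:
  fixes c :: "nat \<Rightarrow> complex"
  assumes c: "\<And>n. cmod (c n) \<le> B"
  defines "f \<equiv> \<lambda>z. \<Sum>n. c n * z ^ n"
  shows "f holomorphic_on ball 0 1" and "taylor_coeff f n = c n"
proof -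
  have eval: "f = eval_fps (Abs_fps c)"
    by (rule ext) (simp add: f_def eval_fps_def)
  have "conv_radius c \<ge> 1"
  proof (rule conv_radius_geI_ex')
    fix r :: real assume "0 < r" "ereal r < 1"
    then show "summable (\<lambda>n. c n * of_real r ^ n)"
      by (intro summable_norm_cancel[OF summable_bounded_coeffs[OF c]]) auto
  qed
  then have radius: "fps_conv_radius (Abs_fps c) \<ge> 1"
    by (simp add: fps_conv_radius_def)
  have "ball 0 1 \<subseteq> eball (0::complex) (fps_conv_radius (Abs_fps c))"
  proof
    fix z :: complex assume "z \<in> ball 0 1"
    then have "ereal (cmod z) < 1"
      by simp
    also note radius
    finally show "z \<in> eball 0 (fps_conv_radius (Abs_fps c))"
      by (simp add: in_eball_iff)
  qed
  then show "f holomorphic_on ball 0 1"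
    unfolding eval by (rule holomorphic_on_eval_fps)
  have "f has_fps_expansion Abs_fps c"
    unfolding eval
    by (rule eval_fps_has_fps_expansion, rule less_le_trans[OF _ radius]) simp
  from fps_nth_fps_expansion[OF this, of n] show "taylor_coeff f n = c n"
    by (simp add: taylor_coeff_def)
qed

text \<open>Point evaluation is continuous on the Hardy space, since every Taylor coefficient is
  bounded by the norm.\<close>

lemma H2_pointwise_bound:
  assumes f: "f \<in> H2" and z: "z \<in> ball 0 1"
  shows "cmod (f z) \<le> H2_norm f / (1 - cmod z)"
proof -
  let ?a = "taylor_coeff f"
  have z1: "cmod z < 1"
    using z by simp
  have "(\<lambda>n. (deriv ^^ n) f 0 / fact n * (z - 0) ^ n) sums f z"
    using f z by (intro holomorphic_power_series[of f 0 1]) (auto simp: H2_def)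
  then have sums: "(\<lambda>n. ?a n * z ^ n) sums f z"
    by (simp add: taylor_coeff_def)
  have bound: "cmod (?a n) \<le> H2_norm f" for n
  proof -
    have "(\<Sum>k\<in>{n}. (cmod (?a k))\<^sup>2) \<le> (\<Sum>k. (cmod (?a k))\<^sup>2)"
      using f by (intro sum_le_suminf) (auto simp: H2_def)
    then show ?thesis
      by (auto simp: H2_norm_def intro: real_le_rsqrt)
  qed
  have "cmod (f z) = cmod (\<Sum>n. ?a n * z ^ n)"
    using sums by (simp add: sums_iff)
  also have "\<dots> \<le> (\<Sum>n. H2_norm f * cmod z ^ n)"
  proof (rule order_trans[OF summable_norm])
    show s: "summable (\<lambda>n. norm (?a n * z ^ n))"
      using bound z1 by (rule summable_bounded_coeffs)
    show "(\<Sum>n. norm (?a n * z ^ n)) \<le> (\<Sum>n. H2_norm f * cmod z ^ n)"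
      using bound s z1
      by (intro suminf_le summable_mult summable_geometric)
         (auto simp: norm_mult norm_power intro: mult_right_mono)
  qed
  also have "\<dots> = H2_norm f / (1 - cmod z)"
    using z1 by (simp add: suminf_mult suminf_geometric)
  finally show ?thesis .
qed

section \<open>The embedding of an orthonormal basis as monomials\<close>

definition monomial_embedding ::
    "'a measure \<Rightarrow> nat set \<Rightarrow> (nat \<Rightarrow> 'a \<Rightarrow> complex) \<Rightarrow> ('a \<Rightarrow> complex) \<Rightarrow> complex \<Rightarrow> complex" where
  "monomial_embedding M \<Gamma> b f z = (\<Sum>n. (if n \<in> \<Gamma> then L2_inner M (b n) f else 0) * z ^ n)"

lemma monomial_embedding_isometric:
  assumes onb: "orthonormal_basis_L2 M \<Gamma> b"
  shows "isometric_embedding_L2_H2 M (monomial_embedding M \<Gamma> b)"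
proof -
  let ?J = "monomial_embedding M \<Gamma> b"
  define c where "c f n = (if n \<in> \<Gamma> then L2_inner M (b n) f else 0)" for f n
  have J: "?J f = (\<lambda>z. \<Sum>n. c f n * z ^ n)" for f
    by (rule ext) (simp add: monomial_embedding_def c_def)
  have b: "b n \<in> L2 M" if "n \<in> \<Gamma>" for n
    using onb that by (auto simp: orthonormal_basis_L2_def)
  have sums: "(\<lambda>n. (cmod (c f n))\<^sup>2) sums (L2_norm M f)\<^sup>2" if f: "f \<in> L2 M" for f
  proof -
    have "((\<lambda>n. (cmod (c f n))\<^sup>2) has_sum (L2_norm M f)\<^sup>2) UNIV \<longleftrightarrow>
        ((\<lambda>n. (cmod (L2_inner M (b n) f))\<^sup>2) has_sum (L2_norm M f)\<^sup>2) \<Gamma>"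
      by (rule has_sum_cong_neutral) (auto simp: c_def)
    with parseval[OF onb f] show ?thesis
      by (simp add: has_sum_imp_sums)
  qed
  have bound: "cmod (c f n) \<le> L2_norm M f" if f: "f \<in> L2 M" for f n
  proof -
    have "(\<Sum>k\<in>{n}. (cmod (c f k))\<^sup>2) \<le> (\<Sum>k. (cmod (c f k))\<^sup>2)"
      using sums[OF f] by (intro sum_le_suminf) (auto simp: sums_iff)
    then have "(cmod (c f n))\<^sup>2 \<le> (L2_norm M f)\<^sup>2"
      using sums[OF f] by (simp add: sums_iff)
    then show ?thesis
      using L2_norm_nonneg by (rule power2_le_imp_le)
  qed
  have taylor: "taylor_coeff (?J f) n = c f n" if "f \<in> L2 M" for f n
    unfolding J using bound[OF that] by (rule power_series_on_disk)
  have H2: "?J f \<in> H2" if f: "f \<in> L2 M" for f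
  proof -
    have "?J f holomorphic_on ball 0 1"
      unfolding J using bound[OF f] by (rule power_series_on_disk)
    with sums[OF f] show ?thesis
      by (auto simp: H2_def taylor[OF f] sums_iff)
  qed
  have norm: "H2_norm (?J f) = L2_norm M f" if f: "f \<in> L2 M" for f
    using sums[OF f] L2_norm_nonneg[of M f] by (simp add: H2_norm_def taylor[OF f] sums_iff)
  have cong: "?J f z = ?J g z"
    if f: "f \<in> L2 M" and g: "g \<in> L2 M" and eq: "AE x in M. f x = g x" for f g z
  proof -
    have "L2_inner M (b n) f = L2_inner M (b n) g" if "n \<in> \<Gamma>" for n
    proof -
      have [measurable]: "f \<in> borel_measurable M" "g \<in> borel_measurable M"
          "b n \<in> borel_measurable M"
        using f g b[OF that] by (auto simp: L2_def)
      show ?thesis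
        unfolding L2_inner_def
        by (rule integral_cong_AE) (use eq in auto)
    qed
    then have "c f = c g"
      by (auto simp: c_def fun_eq_iff)
    then show ?thesis
      by (simp add: J)
  qed
  have lin: "?J (\<lambda>x. u * f x + v * g x) z = u * ?J f z + v * ?J g z"
    if f: "f \<in> L2 M" and g: "g \<in> L2 M" and z: "z \<in> ball 0 1" for f g u v z
  proof -
    have cl: "c (\<lambda>x. u * f x + v * g x) n = u * c f n + v * c g n" for n
      using L2_inner_lincomb[OF b f g] by (cases "n \<in> \<Gamma>") (auto simp: c_def)
    have s: "summable (\<lambda>n. c h n * z ^ n)" if "h \<in> L2 M" for h
      using summable_bounded_coeffs[of "c h" _ z, OF bound[OF that]] z
      by (simp add: summable_norm_cancel)
    have "?J (\<lambda>x. u * f x + v * g x) z = (\<Sum>n. u * (c f n * z ^ n) + v * (c g n * z ^ n))"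
      unfolding J cl by (simp add: algebra_simps)
    also have "\<dots> = (\<Sum>n. u * (c f n * z ^ n)) + (\<Sum>n. v * (c g n * z ^ n))"
      using s f g by (intro suminf_add[symmetric] summable_mult) auto
    also have "\<dots> = u * ?J f z + v * ?J g z"
      using s f g unfolding J by (simp add: suminf_mult)
    finally show ?thesis .
  qed
  show ?thesis
    unfolding isometric_embedding_L2_H2_def
    by (intro conjI ballI allI impI H2 norm cong lin)
qed

lemma monomial_embedding_basis:
  assumes "orthonormal_basis_L2 M \<Gamma> b" "k \<in> \<Gamma>"
  shows "monomial_embedding M \<Gamma> b (b k) z = z ^ k"
proof -
  have "monomial_embedding M \<Gamma> b (b k) z = (\<Sum>n. if n = k then z ^ n else 0)"
    unfolding monomial_embedding_def using assms
    by (intro suminf_cong) (auto simp: orthonormal_basis_L2_def)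
  also have "\<dots> = z ^ k"
    using sums_unique[OF sums_single[of k "\<lambda>n. z ^ n"]] by simp
  finally show ?thesis .
qed

lemma isometric_embedding_sum:
  assumes J: "isometric_embedding_L2_H2 M J" and z: "z \<in> ball 0 1"
    and F: "finite F" and b: "\<And>i. i \<in> F \<Longrightarrow> b i \<in> L2 M"
  shows "J (\<lambda>x. \<Sum>i\<in>F. a i * b i x) z = (\<Sum>i\<in>F. a i * J (b i) z)"
proof -
  have lin: "J (\<lambda>x. u * f x + v * g x) z = u * J f z + v * J g z"
    if "f \<in> L2 M" "g \<in> L2 M" for f g u v
    using J z that unfolding isometric_embedding_L2_H2_def by blast
  show ?thesis
    using F b
  proof (induction F rule: finite_induct)
    case empty
    show ?case
      using lin[of "\<lambda>x. 0" "\<lambda>x. 0" 0 0] by (simp add: zero_in_L2)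
  next
    case (insert i F)
    have "J (\<lambda>x. a i * b i x + 1 * (\<Sum>i\<in>F. a i * b i x)) z
        = a i * J (b i) z + 1 * J (\<lambda>x. \<Sum>i\<in>F. a i * b i x) z"
      using insert by (intro lin L2_sum) auto
    then show ?case
      using insert by simp
  qed
qed

text \<open>Both embeddings agree on the span of the basis; density and the continuity of point
  evaluations carry the agreement over to all of \<open>L\<^sup>2\<close>.\<close>

lemma isometric_embedding_unique:
  assumes onb: "orthonormal_basis_L2 M I b"
    and J: "isometric_embedding_L2_H2 M J" and J': "isometric_embedding_L2_H2 M J'"
    and agree: "\<And>i. i \<in> I \<Longrightarrow> J (b i) z = J' (b i) z"
    and f: "f \<in> L2 M" and z: "z \<in> ball 0 1"
  shows "J f z = J' f z"
proof -
  have z1: "1 - cmod z > 0"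
    using z by simp
  have "cmod (J f z - J' f z) \<le> 0 + e" if "e > 0" for e
  proof -
    define d where "d = e * (1 - cmod z) / 2"
    have "d > 0"
      using that z1 by (simp add: d_def)
    then obtain F a where F: "finite F" "F \<subseteq> I"
      and d: "L2_norm M (\<lambda>x. f x - (\<Sum>i\<in>F. a i * b i x)) < d"
      using onb f unfolding orthonormal_basis_L2_def by meson
    define s where "s = (\<lambda>x. \<Sum>i\<in>F. a i * b i x)"
    define h where "h = (\<lambda>x. 1 * f x + (-1) * s x)"
    have bF: "b i \<in> L2 M" if "i \<in> F" for i
      using onb F that by (auto simp: orthonormal_basis_L2_def)
    have s: "s \<in> L2 M"
      unfolding s_def using F(1) bF by (rule L2_sum)
    have h: "h \<in> L2 M"
      unfolding h_def using f s by (rule L2_lincomb)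
    have hd: "L2_norm M h < d"
      using d by (simp add: h_def s_def)
    have diff: "K h z = K f z - K s z" and small: "cmod (K h z) \<le> d / (1 - cmod z)"
      if K: "isometric_embedding_L2_H2 M K" for K
    proof -
      have "K h z = 1 * K f z + (-1) * K s z"
        using K f s z unfolding h_def isometric_embedding_L2_H2_def by blast
      then show "K h z = K f z - K s z"
        by simp
      have "cmod (K h z) \<le> H2_norm (K h) / (1 - cmod z)"
        using K h z unfolding isometric_embedding_L2_H2_def
        by (intro H2_pointwise_bound) blast+
      also have "H2_norm (K h) = L2_norm M h"
        using K h unfolding isometric_embedding_L2_H2_def by blast
      finally show "cmod (K h z) \<le> d / (1 - cmod z)"
        using hd z1 by (smt (verit) divide_right_mono)
    qed
    have "K s z = (\<Sum>i\<in>F. a i * K (b i) z)" if "isometric_embedding_L2_H2 M K" for K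
      unfolding s_def using that z F(1) bF by (rule isometric_embedding_sum)
    moreover have "(\<Sum>i\<in>F. a i * J (b i) z) = (\<Sum>i\<in>F. a i * J' (b i) z)"
      using agree F by (intro sum.cong) auto
    ultimately have "J s z = J' s z"
      using J J' by simp
    then have "J f z - J' f z = J h z - J' h z"
      by (simp add: diff[OF J] diff[OF J'])
    also have "cmod \<dots> \<le> d / (1 - cmod z) + d / (1 - cmod z)"
      by (intro order_trans[OF norm_triangle_ineq4] add_mono small J J')
    also have "d / (1 - cmod z) = e / 2"
      using z1 by (subst nonzero_divide_eq_eq) (auto simp: d_def)
    finally show ?thesis
      by simp
  qed
  then have "cmod (J f z - J' f z) \<le> 0"
    by (rule field_le_epsilon)
  then show ?thesis
    by simp
qed

section \<open>The reproducing kernel\<close>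

text \<open>The kernel depends on \<^term>\<open>z\<close> and \<^term>\<open>x\<close> only through the product of \<^term>\<open>z\<close>
  with the conjugate of \<^term>\<open>char_exp 1 x\<close>, and in that variable it is the series below. The
  type is kept general because its values at nonnegative reals serve as majorants.\<close>

definition gap_series :: "nat set \<Rightarrow> 'a::{real_normed_field,banach} \<Rightarrow> 'a" where
  "gap_series A w = (\<Sum>\<^sub>\<infinity>n\<in>A. w ^ n)"

lemma gap_series_summable:
  fixes w :: "'a::{real_normed_field,banach}"
  assumes "norm w < 1"
  shows "(\<lambda>n. w ^ n) summable_on A"
proof -
  have "(\<lambda>n. w ^ n) summable_on UNIV"
    using assms by (intro norm_summable_imp_summable_on) (simp add: norm_power summable_geometric)
  then show ?thesis
    by (rule summable_on_subset_banach) simp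
qed

lemma gap_series_sums:
  fixes w :: "'a::{real_normed_field,banach}"
  assumes "norm w < 1"
  shows "(\<lambda>n. if n \<in> A then w ^ n else 0) sums gap_series A w"
proof -
  have "((\<lambda>n. w ^ n) has_sum gap_series A w) A"
    unfolding gap_series_def using gap_series_summable[OF assms] by (rule has_sum_infsum)
  moreover have "((\<lambda>n. if n \<in> A then w ^ n else 0) has_sum gap_series A w) UNIV \<longleftrightarrow>
      ((\<lambda>n. w ^ n) has_sum gap_series A w) A"
    by (rule has_sum_cong_neutral) auto
  ultimately show ?thesis
    by (simp add: has_sum_imp_sums)
qed

lemma cmod_char_exp [simp]: "cmod (char_exp t x) = 1"
  by (simp add: char_exp_def norm_exp_eq_Re)

lemma char_exp_power: "char_exp (real n) x = char_exp 1 x ^ n"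
  by (simp add: char_exp_def exp_of_nat_mult[symmetric] mult_ac)

lemma char_exp_measurable:
  assumes "sets \<mu> = sets borel"
  shows "char_exp t \<in> borel_measurable \<mu>"
proof -
  have "continuous_on UNIV (char_exp t)"
    unfolding char_exp_def by (intro continuous_intros)
  then have "char_exp t \<in> borel_measurable borel"
    by (rule borel_measurable_continuous_onI)
  then show ?thesis
    using measurable_cong_sets[OF assms refl] by blast
qed

lemma G_summand: "cnj z ^ n * char_exp (real n) x = (cnj (z * cnj (char_exp 1 x))) ^ n"
  by (simp add: char_exp_power power_mult_distrib)

lemma G_eq_gap_series: "G \<Gamma> z x = gap_series \<Gamma> (cnj (z * cnj (char_exp 1 x)))"
  unfolding G_def gap_series_def G_summand ..

lemma cnj_G_eq_gap_series: "cnj (G \<Gamma> z x) = gap_series \<Gamma> (z * cnj (char_exp 1 x))"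
  unfolding G_eq_gap_series gap_series_def by (simp flip: infsum_cnj)

lemma norm_gap_series_le:
  fixes w :: "'a::{real_normed_field,banach}"
  assumes "norm w < 1"
  shows "norm (gap_series A w) \<le> 1 / (1 - norm w)"
proof -
  let ?t = "\<lambda>n. if n \<in> A then w ^ n else 0"
  have s: "summable (\<lambda>n. norm (?t n))"
    by (rule summable_comparison_test'[OF summable_geometric[of "norm w"]])
       (use assms in \<open>auto simp: norm_power\<close>)
  have "norm (gap_series A w) = norm (\<Sum>n. ?t n)"
    using gap_series_sums[OF assms] by (simp add: sums_iff)
  also have "\<dots> \<le> (\<Sum>n. norm (?t n))"
    using s by (rule summable_norm)
  also have "\<dots> \<le> (\<Sum>n. norm w ^ n)"
    using s assms by (intro suminf_le summable_geometric) (auto simp: norm_power)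
  also have "\<dots> = 1 / (1 - norm w)"
    using assms by (simp add: suminf_geometric)
  finally show ?thesis .
qed

lemma G_in_L2:
  assumes "prob_space \<mu>" "sets \<mu> = sets borel" "cmod z < 1"
  shows "G \<Gamma> z \<in> L2 \<mu>"
proof -
  interpret prob_space \<mu> by fact
  note char_exp_measurable[OF assms(2), measurable]
  let ?w = "\<lambda>x. cnj (z * cnj (char_exp 1 x))"
  have w: "cmod (?w x) < 1" for x
    using assms(3) by (simp add: norm_mult)
  have "G \<Gamma> z = (\<lambda>x. \<Sum>n. if n \<in> \<Gamma> then ?w x ^ n else 0)"
    using gap_series_sums[OF w] by (simp add: fun_eq_iff G_eq_gap_series sums_iff)
  also have "\<dots> \<in> borel_measurable \<mu>"
  proof (rule borel_measurable_suminf)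
    show "(\<lambda>x. if n \<in> \<Gamma> then ?w x ^ n else 0) \<in> borel_measurable \<mu>" for n
      by (cases "n \<in> \<Gamma>") auto
  qed
  finally have meas [measurable]: "G \<Gamma> z \<in> borel_measurable \<mu>" .
  have bound: "cmod (G \<Gamma> z x) \<le> 1 / (1 - cmod z)" for x
    using norm_gap_series_le[OF w, of \<Gamma> x] by (simp add: G_eq_gap_series norm_mult)
  have "integrable \<mu> (\<lambda>x. (cmod (G \<Gamma> z x))\<^sup>2)"
  proof (rule integrable_const_bound)
    show "AE x in \<mu>. norm ((cmod (G \<Gamma> z x))\<^sup>2) \<le> (1 / (1 - cmod z))\<^sup>2"
      using bound by (intro AE_I2) (auto intro: power_mono)
  qed measurable
  with meas show ?thesis
    by (simp add: L2_def)
qed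

text \<open>Summation and integration may be exchanged because the \<open>n\<close>-th summand is at most
  \<open>\<bar>z\<bar>\<^sup>n \<bar>f\<bar>\<close> and a square-integrable function is integrable for a probability
  measure.\<close>

lemma monomial_embedding_eq_kernel_integral:
  assumes P: "prob_space \<mu>" and borel: "sets \<mu> = sets borel"
    and f: "f \<in> L2 \<mu>" and z: "cmod z < 1"
  shows "monomial_embedding \<mu> \<Gamma> (\<lambda>n. char_exp (real n)) f z = (LINT x|\<mu>. f x * cnj (G \<Gamma> z x))"
proof -
  interpret prob_space \<mu> by fact
  note char_exp_measurable[OF borel, measurable]
  have [measurable]: "f \<in> borel_measurable \<mu>"
    using f by (simp add: L2_def)
  have "(\<lambda>x. 1) \<in> L2 \<mu>"
    by (simp add: L2_def)
  from integrable_L2_mult[OF this f] have intf: "integrable \<mu> f"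
    by simp
  define t where "t n x = (if n \<in> \<Gamma> then f x * (z * cnj (char_exp 1 x)) ^ n else 0)" for n x
  have t_le: "norm (t n x) \<le> cmod (f x) * cmod z ^ n" for n x
    by (simp add: t_def norm_mult norm_power)
  have t_int: "integrable \<mu> (t n)" for n
  proof (rule Bochner_Integration.integrable_bound)
    show "integrable \<mu> (\<lambda>x. cmod (f x) * cmod z ^ n)"
      using intf by simp
    show "t n \<in> borel_measurable \<mu>"
      unfolding t_def by (cases "n \<in> \<Gamma>") auto
    show "AE x in \<mu>. norm (t n x) \<le> norm (cmod (f x) * cmod z ^ n)"
      using t_le by (simp add: norm_mult norm_power)
  qed
  have t_sums: "(\<lambda>n. t n x) sums (f x * cnj (G \<Gamma> z x))" for x
  proof -
    have "(\<lambda>n. f x * (if n \<in> \<Gamma> then (z * cnj (char_exp 1 x)) ^ n else 0))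
        sums (f x * cnj (G \<Gamma> z x))"
      unfolding cnj_G_eq_gap_series
      using z by (intro sums_mult gap_series_sums) (simp add: norm_mult)
    then show ?thesis
      by (simp add: t_def if_distrib cong: if_cong)
  qed
  have summable_x: "AE x in \<mu>. summable (\<lambda>n. norm (t n x))"
  proof (rule AE_I2)
    fix x
    show "summable (\<lambda>n. norm (t n x))"
      using z t_le
      by (intro summable_comparison_test'[OF summable_mult[OF summable_geometric[of "cmod z"]]])
         auto
  qed
  have summable_int: "summable (\<lambda>n. LINT x|\<mu>. norm (t n x))"
  proof (rule summable_comparison_test')
    show "summable (\<lambda>n. (LINT x|\<mu>. cmod (f x)) * cmod z ^ n)"
      using z by (intro summable_mult summable_geometric) auto
    show "norm (LINT x|\<mu>. norm (t n x)) \<le> (LINT x|\<mu>. cmod (f x)) * cmod z ^ n" for n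
    proof -
      have "(LINT x|\<mu>. norm (t n x)) \<le> (LINT x|\<mu>. cmod (f x) * cmod z ^ n)"
        using intf t_int t_le by (intro integral_mono) auto
      then show ?thesis
        by simp
    qed
  qed
  have coeff: "(LINT x|\<mu>. t n x)
      = (if n \<in> \<Gamma> then L2_inner \<mu> (char_exp (real n)) f else 0) * z ^ n" for n
  proof (cases "n \<in> \<Gamma>")
    case True
    then have "t n = (\<lambda>x. (cnj (char_exp (real n) x) * f x) * z ^ n)"
      by (simp add: t_def fun_eq_iff char_exp_power power_mult_distrib)
    with True show ?thesis
      by (simp add: L2_inner_def)
  qed (simp add: t_def)
  have "(LINT x|\<mu>. f x * cnj (G \<Gamma> z x)) = (LINT x|\<mu>. (\<Sum>n. t n x))"
    using t_sums by (simp add: sums_iff)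
  also have "\<dots> = (\<Sum>n. (LINT x|\<mu>. t n x))"
    using t_int summable_x summable_int by (rule integral_suminf)
  finally show ?thesis
    by (simp add: coeff monomial_embedding_def)
qed

section \<open>The product formula for self-similar exponent sets\<close>

lemma zero_in_digit_set:
  fixes \<Gamma> L :: "nat set"
  assumes "\<Gamma> \<noteq> {}" "R \<ge> 2" and self: "\<Gamma> = {R * \<gamma> + l |\<gamma> l. \<gamma> \<in> \<Gamma> \<and> l \<in> L}"
  shows "0 \<in> \<Gamma>" and "0 \<in> L"
proof -
  \<comment> \<open>The least exponent \<open>m\<close> is \<open>R\<gamma> + l\<close> for some \<open>\<gamma> \<ge> m\<close>, so \<open>m = \<gamma> = l = 0\<close>.\<close>
  define m where "m = (LEAST n. n \<in> \<Gamma>)"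
  have m: "m \<in> \<Gamma>" and least: "\<And>n. n \<in> \<Gamma> \<Longrightarrow> m \<le> n"
    unfolding m_def using assms(1) by (auto intro: LeastI Least_le)
  from m self obtain \<gamma> l where \<gamma>: "\<gamma> \<in> \<Gamma>" "l \<in> L" "m = R * \<gamma> + l"
    by blast
  have "2 * m \<le> R * \<gamma>"
    using assms(2) least[OF \<gamma>(1)] by (rule mult_le_mono)
  with \<gamma>(3) have "m = 0" "l = 0"
    by auto
  with m \<gamma> show "0 \<in> \<Gamma>" "0 \<in> L"
    by auto
qed

text \<open>Sorting the exponents by their residue modulo \<^term>\<open>R\<close> turns the self-similarity of the
  exponent set into a functional equation.\<close>

lemma gap_series_step:
  fixes w :: "'a::{real_normed_field,banach}" and \<Gamma> L :: "nat set"
  assumes "finite L" and res: "\<And>l l'. l \<in> L \<Longrightarrow> l' \<in> L \<Longrightarrow> l mod R = l' mod R \<Longrightarrow> l = l'"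
    and "R > 0" and self: "\<Gamma> = {R * \<gamma> + l |\<gamma> l. \<gamma> \<in> \<Gamma> \<and> l \<in> L}" and w: "norm w < 1"
  shows "gap_series \<Gamma> w = (\<Sum>l\<in>L. w ^ l) * gap_series \<Gamma> (w ^ R)"
proof -
  define h where "h = (\<lambda>(l, \<gamma>). R * \<gamma> + l)"
  have img: "\<Gamma> = h ` (L \<times> \<Gamma>)"
    by (subst self) (auto simp: h_def)
  have inj: "inj_on h (L \<times> \<Gamma>)"
  proof (rule inj_onI, clarsimp simp: h_def)
    fix l l' \<gamma> \<gamma>' assume L: "l \<in> L" "l' \<in> L" and eq: "R * \<gamma> + l = R * \<gamma>' + l'"
    then have "l mod R = l' mod R"
      by (metis mod_mult_self4)
    with L have "l = l'"
      by (rule res)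
    with eq \<open>R > 0\<close> show "l = l' \<and> \<gamma> = \<gamma>'"
      by simp
  qed
  have "(\<lambda>n. w ^ n) summable_on h ` (L \<times> \<Gamma>)"
    using w by (rule gap_series_summable)
  then have summ: "((\<lambda>n. w ^ n) \<circ> h) summable_on (L \<times> \<Gamma>)"
    using summable_on_reindex[OF inj] by blast
  have "gap_series \<Gamma> w = infsum ((\<lambda>n. w ^ n) \<circ> h) (L \<times> \<Gamma>)"
    unfolding gap_series_def by (subst img) (rule infsum_reindex[OF inj])
  also have "\<dots> = (\<Sum>\<^sub>\<infinity>l\<in>L. \<Sum>\<^sub>\<infinity>\<gamma>\<in>\<Gamma>. w ^ l * (w ^ R) ^ \<gamma>)"
    unfolding infsum_Sigma_banach[OF summ, symmetric]
    by (simp add: h_def power_add power_mult mult.commute[of "w ^ _"])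
  also have "\<dots> = (\<Sum>l\<in>L. w ^ l * gap_series \<Gamma> (w ^ R))"
    using \<open>finite L\<close> by (simp add: infsum_cmult_right' gap_series_def)
  finally show ?thesis
    by (simp add: sum_distrib_right)
qed

lemma gap_series_iterate:
  fixes w :: "'a::{real_normed_field,banach}" and \<Gamma> L :: "nat set"
  assumes "finite L" and "\<And>l l'. l \<in> L \<Longrightarrow> l' \<in> L \<Longrightarrow> l mod R = l' mod R \<Longrightarrow> l = l'"
    and "R > 0" and "\<Gamma> = {R * \<gamma> + l |\<gamma> l. \<gamma> \<in> \<Gamma> \<and> l \<in> L}" and w: "norm w < 1"
  shows "gap_series \<Gamma> w
      = (\<Prod>n<N. \<Sum>l\<in>L. (w ^ R ^ n) ^ l) * gap_series \<Gamma> (w ^ R ^ N)"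
proof (induction N)
  case (Suc N)
  have "norm (w ^ R ^ N) < 1"
    using w \<open>R > 0\<close> by (simp add: norm_power power_less_one_iff)
  with assms(1-4) have "gap_series \<Gamma> (w ^ R ^ N)
      = (\<Sum>l\<in>L. (w ^ R ^ N) ^ l) * gap_series \<Gamma> ((w ^ R ^ N) ^ R)"
    by (rule gap_series_step)
  moreover have "(w ^ R ^ N) ^ R = w ^ R ^ Suc N"
    by (simp only: power_mult[symmetric] power_Suc2)
  ultimately show ?case
    unfolding Suc.IH prod.lessThan_Suc by (simp only: mult.assoc)
qed simp

lemma norm_gap_series_minus_1_le:
  fixes w :: "'a::{real_normed_field,banach}"
  assumes "0 \<in> A" and w: "norm w < 1"
  shows "norm (gap_series A w - 1) \<le> norm w / (1 - norm w)"
proof -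
  let ?t = "\<lambda>n. if n \<in> A then w ^ n else 0"
  have "(\<lambda>n. ?t (Suc n)) sums (gap_series A w - 1)"
    using gap_series_sums[OF w, of A] assms(1) by (subst sums_Suc_iff) simp
  then have "gap_series A w - 1 = (\<Sum>n. ?t (Suc n))"
    by (simp add: sums_iff)
  moreover have bound: "norm (?t (Suc n)) \<le> norm w * norm w ^ n" for n
    by (simp add: norm_mult norm_power)
  have geom: "summable (\<lambda>n. norm w * norm w ^ n)"
    using w by (intro summable_mult summable_geometric) simp
  have s: "summable (\<lambda>n. norm (?t (Suc n)))"
    by (rule summable_comparison_test'[OF geom]) (use bound in simp)
  have "norm (\<Sum>n. ?t (Suc n)) \<le> (\<Sum>n. norm w * norm w ^ n)"
    using summable_norm[OF s] suminf_le[OF bound s geom] by linarith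
  moreover have "(\<Sum>n. norm w * norm w ^ n) = norm w / (1 - norm w)"
    using w by (simp add: suminf_mult suminf_geometric)
  ultimately show ?thesis
    by simp
qed

text \<open>By the iterated functional equation the error of a partial product is that product times
  the deviation of the series from 1 at a very small argument. The partial product is in modulus
  at most the one at \<open>r\<close>, hence at most the value of the series at \<open>r\<close>, because the series is at
  least 1 at nonnegative arguments. The resulting bound depends on \<open>w\<close> only through \<open>r\<close>, which
  is what makes the convergence uniform.\<close>

lemma partial_product_error:
  fixes w :: complex and \<Gamma> L :: "nat set"
  assumes "finite L" and res: "\<And>l l'. l \<in> L \<Longrightarrow> l' \<in> L \<Longrightarrow> l mod R = l' mod R \<Longrightarrow> l = l'"
    and R: "R \<ge> 2" and self: "\<Gamma> = {R * \<gamma> + l |\<gamma> l. \<gamma> \<in> \<Gamma> \<and> l \<in> L}" and "0 \<in> \<Gamma>"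
    and w: "cmod w \<le> r" and r: "r < 1"
  shows "cmod ((\<Prod>n<N. \<Sum>l\<in>L. (w ^ R ^ n) ^ l) - gap_series \<Gamma> w) \<le> r ^ N / (1 - r)\<^sup>2"
proof -
  have r0: "0 \<le> r"
    using w norm_ge_zero order_trans by blast
  have R0: "R > 0"
    using R by simp
  let ?P = "\<Prod>n<N. \<Sum>l\<in>L. (w ^ R ^ n) ^ l" and ?Q = "\<Prod>n<N. \<Sum>l\<in>L. (r ^ R ^ n) ^ l"
  have wR: "cmod (w ^ R ^ N) \<le> r ^ N" and rR: "0 \<le> r ^ R ^ N" "r ^ R ^ N < 1"
  proof -
    have "N \<le> R ^ N"
      using R by (rule self_le_ge2_pow)
    then have "r ^ R ^ N \<le> r ^ N"
      using r0 r by (intro power_decreasing) auto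
    moreover have "cmod (w ^ R ^ N) \<le> r ^ R ^ N"
      using w by (simp add: norm_power power_mono)
    ultimately show "cmod (w ^ R ^ N) \<le> r ^ N"
      by linarith
    show "0 \<le> r ^ R ^ N" "r ^ R ^ N < 1"
      using r0 r R0 by (auto simp: power_less_one_iff)
  qed
  have wR1: "cmod (w ^ R ^ N) \<le> r"
  proof -
    have "cmod (w ^ R ^ N) = cmod w ^ R ^ N"
      by (simp add: norm_power)
    also have "\<dots> \<le> cmod w ^ 1"
      using w r R0 by (intro power_decreasing) (auto simp: Suc_le_eq)
    finally show ?thesis
      using w by simp
  qed
  have "cmod ?P \<le> ?Q"
    using w by (simp add: prod_norm[symmetric])
      (intro prod_mono conjI norm_ge_zero sum_norm_le, auto simp: norm_power intro!: power_mono)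
  also have "?Q \<le> 1 / (1 - r)"
  proof -
    have Q0: "0 \<le> ?Q"
      using r0 by (intro prod_nonneg sum_nonneg) auto
    have ge1: "1 \<le> gap_series \<Gamma> (r ^ R ^ N)"
    proof -
      have s: "(\<lambda>n. if n \<in> \<Gamma> then (r ^ R ^ N) ^ n else 0) sums gap_series \<Gamma> (r ^ R ^ N)"
        using rR by (intro gap_series_sums) simp
      have "(\<Sum>n\<in>{0}. if n \<in> \<Gamma> then (r ^ R ^ N) ^ n else 0) \<le> gap_series \<Gamma> (r ^ R ^ N)"
        unfolding sums_unique[OF s]
        using sums_summable[OF s] rR by (intro sum_le_suminf) auto
      then show ?thesis
        using \<open>0 \<in> \<Gamma>\<close> by simp
    qed
    have "?Q \<le> ?Q * gap_series \<Gamma> (r ^ R ^ N)"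
      using mult_left_mono[OF ge1 Q0] by simp
    also have "\<dots> = gap_series \<Gamma> r"
    proof (rule gap_series_iterate[symmetric, OF assms(1) _ R0 self])
      show "norm r < 1"
        using r r0 by simp
    qed (rule res)
    also have "\<dots> \<le> 1 / (1 - r)"
      using norm_gap_series_le[of r \<Gamma>] r r0 by simp
    finally show ?thesis .
  qed
  finally have P: "cmod ?P \<le> 1 / (1 - r)" .
  have "cmod (gap_series \<Gamma> (w ^ R ^ N) - 1) \<le> cmod (w ^ R ^ N) / (1 - cmod (w ^ R ^ N))"
    using \<open>0 \<in> \<Gamma>\<close> wR1 r by (intro norm_gap_series_minus_1_le) auto
  also have "\<dots> \<le> r ^ N / (1 - r)"
    using wR wR1 r r0 by (intro frac_le) auto
  finally have tail: "cmod (gap_series \<Gamma> (w ^ R ^ N) - 1) \<le> r ^ N / (1 - r)" .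
  have "gap_series \<Gamma> w = ?P * gap_series \<Gamma> (w ^ R ^ N)"
  proof (rule gap_series_iterate[OF assms(1) _ R0 self])
    show "cmod w < 1"
      using w r by simp
  qed (rule res)
  then have "?P - gap_series \<Gamma> w = - (?P * (gap_series \<Gamma> (w ^ R ^ N) - 1))"
    by (simp add: algebra_simps)
  then have "cmod (?P - gap_series \<Gamma> w) = cmod ?P * cmod (gap_series \<Gamma> (w ^ R ^ N) - 1)"
    by (simp add: norm_mult)
  also have "\<dots> \<le> 1 / (1 - r) * (r ^ N / (1 - r))"
    using P tail r by (intro mult_mono) auto
  also have "\<dots> = r ^ N / (1 - r)\<^sup>2"
    by (simp add: power2_eq_square)
  finally show ?thesis .
qed

text \<open>A convergent product in the strict sense has only finitely many zero factors and a nonzero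
  limit of the remaining ones, so convergence of the partial products alone does not suffice;
  the factors differ from 1 by a summable amount.\<close>

lemma has_prod_gap_series:
  fixes w :: complex and \<Gamma> L :: "nat set"
  assumes "finite L" and res: "\<And>l l'. l \<in> L \<Longrightarrow> l' \<in> L \<Longrightarrow> l mod R = l' mod R \<Longrightarrow> l = l'"
    and R: "R \<ge> 2" and self: "\<Gamma> = {R * \<gamma> + l |\<gamma> l. \<gamma> \<in> \<Gamma> \<and> l \<in> L}"
    and "0 \<in> \<Gamma>" "0 \<in> L" and w: "cmod w < 1"
  shows "(\<lambda>n. \<Sum>l\<in>L. (w ^ R ^ n) ^ l) has_prod gap_series \<Gamma> w"
proof -
  let ?p = "\<lambda>n. \<Sum>l\<in>L. (w ^ R ^ n) ^ l"
  have "summable (\<lambda>n. norm (?p n - 1))"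
  proof (rule summable_comparison_test')
    show "summable (\<lambda>n. real (card (L - {0})) * cmod w ^ n)"
      using w by (intro summable_mult summable_geometric) auto
    fix n
    have "?p n - 1 = (\<Sum>l\<in>L - {0}. (w ^ R ^ n) ^ l)"
      using \<open>finite L\<close> \<open>0 \<in> L\<close> by (simp add: sum.remove[of L 0])
    also have "cmod \<dots> \<le> real (card (L - {0})) * cmod w ^ n"
    proof (rule sum_norm_bound)
      fix l assume "l \<in> L - {0}"
      moreover have "n \<le> R ^ n"
        using R by (rule self_le_ge2_pow)
      ultimately have "n \<le> R ^ n * l"
        using mult_le_mono[of n "R ^ n" 1 l] by simp
      then show "cmod ((w ^ R ^ n) ^ l) \<le> cmod w ^ n"
        using w by (simp add: norm_power flip: power_mult) (intro power_decreasing; simp)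
    qed
    finally show "norm (norm (?p n - 1)) \<le> real (card (L - {0})) * cmod w ^ n"
      by simp
  qed
  then have conv: "convergent_prod ?p"
    by (intro abs_convergent_prod_imp_convergent_prod summable_imp_abs_convergent_prod)
  have error: "cmod ((\<Prod>n<N. ?p n) - gap_series \<Gamma> w) \<le> cmod w ^ N / (1 - cmod w)\<^sup>2" for N
    by (rule partial_product_error[OF assms(1) _ R self \<open>0 \<in> \<Gamma>\<close> order_refl w], rule res)
  have "(\<lambda>N. \<Prod>n<N. ?p n) \<longlonglongrightarrow> gap_series \<Gamma> w"
  proof (rule LIM_zero_cancel, rule Lim_null_comparison)
    show "\<forall>\<^sub>F N in sequentially. norm ((\<Prod>n<N. ?p n) - gap_series \<Gamma> w)
        \<le> cmod w ^ N / (1 - cmod w)\<^sup>2"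
      using error by simp
    have "(\<lambda>N. cmod w ^ N / (1 - cmod w)\<^sup>2) \<longlonglongrightarrow> 0 / (1 - cmod w)\<^sup>2"
      using w by (intro tendsto_divide LIMSEQ_power_zero tendsto_const) auto
    then show "(\<lambda>N. cmod w ^ N / (1 - cmod w)\<^sup>2) \<longlonglongrightarrow> 0"
      by simp
  qed
  then have "(\<lambda>N. \<Prod>n\<le>N. ?p n) \<longlonglongrightarrow> gap_series \<Gamma> w"
    by (simp add: LIMSEQ_lessThan_iff_atMost)
  with convergent_prod_LIMSEQ[OF conv] have "prodinf ?p = gap_series \<Gamma> w"
    by (rule LIMSEQ_unique)
  with conv show ?thesis
    by (simp add: has_prod_iff)
qed

lemma uniform_limit_partial_products:
  fixes \<Gamma> L :: "nat set"
  assumes "finite L" and res: "\<And>l l'. l \<in> L \<Longrightarrow> l' \<in> L \<Longrightarrow> l mod R = l' mod R \<Longrightarrow> l = l'"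
    and R: "R \<ge> 2" and self: "\<Gamma> = {R * \<gamma> + l |\<gamma> l. \<gamma> \<in> \<Gamma> \<and> l \<in> L}" and "0 \<in> \<Gamma>"
    and r: "0 \<le> r" "r < 1"
  shows "uniform_limit (cball 0 r) (\<lambda>N w. \<Prod>n<N. \<Sum>l\<in>L. (w ^ R ^ n) ^ l)
      (gap_series \<Gamma> :: complex \<Rightarrow> complex) sequentially"
proof (rule uniform_limitI)
  fix e :: real assume "e > 0"
  have "(\<lambda>N. r ^ N / (1 - r)\<^sup>2) \<longlonglongrightarrow> 0 / (1 - r)\<^sup>2"
    using r by (intro tendsto_divide LIMSEQ_power_zero tendsto_const) auto
  then have "\<forall>\<^sub>F N in sequentially. r ^ N / (1 - r)\<^sup>2 < e"
    using \<open>e > 0\<close> by (intro order_tendstoD(2)) auto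
  then show "\<forall>\<^sub>F N in sequentially. \<forall>w\<in>cball 0 r.
      dist (\<Prod>n<N. \<Sum>l\<in>L. (w ^ R ^ n) ^ l) (gap_series \<Gamma> w :: complex) < e"
  proof eventually_elim
    case (elim N)
    show ?case
    proof
      fix w :: complex assume "w \<in> cball 0 r"
      then have "cmod w \<le> r"
        by simp
      have "cmod ((\<Prod>n<N. \<Sum>l\<in>L. (w ^ R ^ n) ^ l) - gap_series \<Gamma> w) \<le> r ^ N / (1 - r)\<^sup>2"
        by (rule partial_product_error
            [OF assms(1) _ R self \<open>0 \<in> \<Gamma>\<close> \<open>cmod w \<le> r\<close> r(2)], rule res)
      with elim show "dist (\<Prod>n<N. \<Sum>l\<in>L. (w ^ R ^ n) ^ l) (gap_series \<Gamma> w) < e"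
        unfolding dist_norm by linarith
    qed
  qed
qed

lemma G_factor_eq: "G_factor R L n z x = (\<Sum>l\<in>L. ((z * cnj (char_exp 1 x)) ^ R ^ n) ^ l)"
proof -
  have "char_exp (real l) (real R ^ n * x) = char_exp 1 x ^ (R ^ n * l)" for l
    unfolding char_exp_power[symmetric] by (simp add: char_exp_def mult_ac)
  then show ?thesis
    by (simp add: G_factor_def power_mult_distrib power_mult[symmetric])
qed

lemma spectrum_orthonormal_basis:
  assumes "is_spectrum \<mu> (real ` \<Gamma>)"
  shows "orthonormal_basis_L2 \<mu> \<Gamma> (\<lambda>n. char_exp (real n))"
proof -
  have "\<exists>F c. finite F \<and> F \<subseteq> \<Gamma> \<and> L2_norm \<mu> (\<lambda>x. f x - (\<Sum>i\<in>F. c i * char_exp (real i) x)) < e"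
    if "f \<in> L2 \<mu>" "e > 0" for f and e :: real
  proof -
    obtain F c where F: "finite F" "F \<subseteq> real ` \<Gamma>"
      and d: "L2_norm \<mu> (\<lambda>x. f x - (\<Sum>t\<in>F. c t * char_exp t x)) < e"
      using assms \<open>f \<in> L2 \<mu>\<close> \<open>e > 0\<close> unfolding is_spectrum_def orthonormal_basis_L2_def by meson
    obtain F' where F': "F' \<subseteq> \<Gamma>" "finite F'" "F = real ` F'"
      using finite_subset_image[OF F] by blast
    have "(\<Sum>t\<in>F. c t * char_exp t x) = (\<Sum>i\<in>F'. c (real i) * char_exp (real i) x)" for x
      unfolding F'(3) by (subst sum.reindex) (auto simp: inj_on_def)
    with d F' show ?thesis
      by (intro exI[of _ F'] exI[of _ "\<lambda>i. c (real i)"]) simp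
  qed
  with assms show ?thesis
    by (auto simp: is_spectrum_def orthonormal_basis_L2_def)
qed

text \<open>An empty orthonormal basis would force the constant function 1 to be null.\<close>

lemma spectrum_nonempty:
  assumes "prob_space \<mu>" and onb: "orthonormal_basis_L2 \<mu> I b"
  shows "I \<noteq> {}"
proof
  interpret prob_space \<mu> by fact
  assume "I = {}"
  have "(\<lambda>x. 1) \<in> L2 \<mu>"
    by (simp add: L2_def)
  from infsumI[OF parseval[OF onb this]] \<open>I = {}\<close> have "(L2_norm \<mu> (\<lambda>x. 1))\<^sup>2 = 0"
    by simp
  then show False
    by (simp add: L2_norm_def prob_space)
qed

theorem theorem2p2:
  fixes \<mu> :: "real measure" and \<Gamma> :: "nat set"
  assumes "prob_space \<mu>" and "sets \<mu> = sets borel"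
    and "is_spectrum \<mu> (real ` \<Gamma>)"
  shows
    "(\<exists>J. spectrum_embedding \<mu> \<Gamma> J) \<and>
     (\<forall>z\<in>ball 0 1.
        (\<forall>x. (\<lambda>\<gamma>. cnj z ^ \<gamma> * char_exp (real \<gamma>) x) summable_on \<Gamma>) \<and>
        G \<Gamma> z \<in> L2 \<mu>) \<and>
     (\<forall>J. spectrum_embedding \<mu> \<Gamma> J \<longrightarrow>
        (\<forall>f\<in>L2 \<mu>. \<forall>z\<in>ball 0 1.
           J f z = (LINT x|\<mu>. f x * cnj (G \<Gamma> z x)) \<and>
           J f z = L2_inner \<mu> (G \<Gamma> z) f)) \<and>
     (\<forall>(R::nat) (L::nat set).
        R \<ge> 2 \<and> finite L \<and> (\<forall>l\<in>L. \<forall>l'\<in>L. l \<noteq> l' \<longrightarrow> l mod R \<noteq> l' mod R) \<and>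
        \<Gamma> = {R * \<gamma> + l |\<gamma> l. \<gamma> \<in> \<Gamma> \<and> l \<in> L} \<longrightarrow>
        (\<forall>z\<in>ball 0 1. \<forall>x. (\<lambda>n. G_factor R L n z x) has_prod cnj (G \<Gamma> z x)) \<and>
        (\<forall>K. compact K \<and> K \<subseteq> ball 0 1 \<longrightarrow>
           uniform_limit (K \<times> UNIV) (\<lambda>N (z, x). \<Prod>n<N. G_factor R L n z x)
             (\<lambda>(z, x). cnj (G \<Gamma> z x)) sequentially))"
proof -
  let ?b = "\<lambda>n. char_exp (real n)"
  let ?J = "monomial_embedding \<mu> \<Gamma> ?b"
  have onb: "orthonormal_basis_L2 \<mu> \<Gamma> ?b"
    using assms(3) by (rule spectrum_orthonormal_basis)
  have J: "spectrum_embedding \<mu> \<Gamma> ?J"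
    unfolding spectrum_embedding_def
    using monomial_embedding_isometric[OF onb] monomial_embedding_basis[OF onb] by blast
  have G: "(\<lambda>\<gamma>. cnj z ^ \<gamma> * char_exp (real \<gamma>) x) summable_on \<Gamma>" "G \<Gamma> z \<in> L2 \<mu>"
    if "z \<in> ball 0 1" for z x
  proof -
    show "(\<lambda>\<gamma>. cnj z ^ \<gamma> * char_exp (real \<gamma>) x) summable_on \<Gamma>"
      unfolding G_summand using that by (intro gap_series_summable) (simp add: norm_mult)
    show "G \<Gamma> z \<in> L2 \<mu>"
      using that by (intro G_in_L2 assms) simp
  qed
  have kernel: "J' f z = (LINT x|\<mu>. f x * cnj (G \<Gamma> z x)) \<and> J' f z = L2_inner \<mu> (G \<Gamma> z) f"
    if J': "spectrum_embedding \<mu> \<Gamma> J'" and f: "f \<in> L2 \<mu>" and z: "z \<in> ball 0 1" for J' f z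
  proof -
    have "J' f z = ?J f z"
    proof (rule isometric_embedding_unique[OF onb _ _ _ f z])
      show "J' (?b n) z = ?J (?b n) z" if "n \<in> \<Gamma>" for n
        using J J' that z by (simp add: spectrum_embedding_def)
    qed (use J J' in \<open>auto simp: spectrum_embedding_def\<close>)
    also have "\<dots> = (LINT x|\<mu>. f x * cnj (G \<Gamma> z x))"
      using z by (intro monomial_embedding_eq_kernel_integral assms f) simp
    finally show ?thesis
      by (simp add: L2_inner_def mult.commute)
  qed
  have product: "(\<forall>z\<in>ball 0 1. \<forall>x. (\<lambda>n. G_factor R L n z x) has_prod cnj (G \<Gamma> z x)) \<and>
      (\<forall>K. compact K \<and> K \<subseteq> ball 0 1 \<longrightarrow>
         uniform_limit (K \<times> UNIV) (\<lambda>N (z, x). \<Prod>n<N. G_factor R L n z x)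
           (\<lambda>(z, x). cnj (G \<Gamma> z x)) sequentially)"
    if R: "R \<ge> 2" and L: "finite L"
      and res: "\<forall>l\<in>L. \<forall>l'\<in>L. l \<noteq> l' \<longrightarrow> l mod R \<noteq> l' mod R"
      and self: "\<Gamma> = {R * \<gamma> + l |\<gamma> l. \<gamma> \<in> \<Gamma> \<and> l \<in> L}" for R L
  proof (intro conjI ballI allI impI)
    have zero: "0 \<in> \<Gamma>" "0 \<in> L"
      using zero_in_digit_set[OF spectrum_nonempty[OF assms(1) onb] R self] by auto
    have res': "l = l'" if "l \<in> L" "l' \<in> L" "l mod R = l' mod R" for l l'
      using res that by blast
    show "(\<lambda>n. G_factor R L n z x) has_prod cnj (G \<Gamma> z x)" if "z \<in> ball 0 1" for z x
      unfolding G_factor_eq cnj_G_eq_gap_series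
    proof (rule has_prod_gap_series[OF L _ R self zero])
      show "cmod (z * cnj (char_exp 1 x)) < 1"
        using that by (simp add: norm_mult)
    qed (rule res')
    fix K :: "complex set" assume K: "compact K \<and> K \<subseteq> ball 0 1"
    obtain r where r: "0 \<le> r" "r < 1" "K \<subseteq> cball 0 r"
    proof (cases "K = {}")
      case False
      then obtain k where k: "k \<in> K" "\<And>z. z \<in> K \<Longrightarrow> cmod z \<le> cmod k"
        using K continuous_attains_sup[of K cmod] by (auto intro: continuous_intros)
      with K show ?thesis
        by (intro that[of "cmod k"]) auto
    qed (use that[of 0] in auto)
    have ball: "uniform_limit (cball 0 r) (\<lambda>N w. \<Prod>n<N. \<Sum>l\<in>L. (w ^ R ^ n) ^ l)
        (gap_series \<Gamma> :: complex \<Rightarrow> complex) sequentially"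
      by (rule uniform_limit_partial_products[OF L _ R self zero(1) r(1,2)], rule res')
    have "uniform_limit (K \<times> UNIV)
        (\<lambda>N p. \<Prod>n<N. \<Sum>l\<in>L. ((fst p * cnj (char_exp 1 (snd p))) ^ R ^ n) ^ l)
        (\<lambda>p. gap_series \<Gamma> (fst p * cnj (char_exp 1 (snd p)))) sequentially"
      using r(3) by (intro uniform_limit_compose'[OF ball]) (auto simp: norm_mult)
    then show "uniform_limit (K \<times> UNIV) (\<lambda>N (z, x). \<Prod>n<N. G_factor R L n z x)
        (\<lambda>(z, x). cnj (G \<Gamma> z x)) sequentially"
      by (simp add: case_prod_unfold G_factor_eq cnj_G_eq_gap_series)
  qed
  show ?thesis
  proof (intro conjI[OF exI[where P="spectrum_embedding \<mu> \<Gamma>", OF J]] conjI[OF ballI conjI])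
    show "(\<forall>x. (\<lambda>\<gamma>. cnj z ^ \<gamma> * char_exp (real \<gamma>) x) summable_on \<Gamma>) \<and> G \<Gamma> z \<in> L2 \<mu>"
      if "z \<in> ball 0 1" for z
      using G[OF that] by blast
  qed ((use kernel in blast), (intro allI impI, elim conjE, rule product))
qed

end
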